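(* Let $\{e_1,e_2,e_3\}$ be the basis of $\mathfrak{su}_2$ with $[e_1,e_2]=-e_3$, $[e_1,e_3]=e_2$, $[e_2,e_3]=-e_1$, let $e_4$ span the factor $\mathbb{R}$ in $\mathfrak{su}_2\oplus\mathbb{R}$, and let $\{e^1,e^2,e^3,e^4\}$ be the dual basis. Up to automorphisms of the Lie algebra, every lcs structure on $\mathfrak{su}_2\oplus\mathbb{R}$ is equivalent to $$(\Omega_r,\vartheta)=\bigl(r(e^{12}+e^{34}),\,e^4\bigr)$$ for some $r>0$.
   Context: $e^{ij}:=e^i\wedge e^j$; $d$ is the Chevalley–Eilenberg differential, so $de^1=e^{23}$, $de^2=-e^{13}$, $de^3=e^{12}$, $de^4=0$. An lcs structure on a $4$-dimensional real Lie algebra $\mathfrak{g}$ is a pair $(\Omega,\vartheta)\in\Lambda^2\mathfrak{g}^*\times\mathfrak{g}^*$ with $\Omega^2\neq0$, $d\vartheta=0$, $d\Omega=\vartheta\wedge\Omega$. Two lcs structures are equivalent if a Lie algebra automorphism of $\mathfrak{g}$ pulls back one pair to the other. *)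

theory Defs
  imports "HOL-Analysis.Analysis"
begin

section \<open>Real Lie algebras\<close>

class real_lie_algebra = real_vector +
  fixes lie :: "'a \<Rightarrow> 'a \<Rightarrow> 'a"
  assumes lie_add_left: "lie (x + y) z = lie x z + lie y z"
    and lie_scaleR_left: "lie (c *\<^sub>R x) z = c *\<^sub>R lie x z"
    and lie_add_right: "lie z (x + y) = lie z x + lie z y"
    and lie_scaleR_right: "lie z (c *\<^sub>R x) = c *\<^sub>R lie z x"
    and lie_self: "lie x x = 0"
    and lie_jacobi: "lie x (lie y z) + lie y (lie z x) + lie z (lie x y) = 0"

instantiation real :: real_lie_algebra
begin

definition lie_real :: "real \<Rightarrow> real \<Rightarrow> real"
  where "lie_real x y = 0"

instance
  by standard (simp_all add: lie_real_def)

end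

text \<open>The direct sum of two Lie algebras is their product type.\<close>

instantiation prod :: (real_lie_algebra, real_lie_algebra) real_lie_algebra
begin

definition lie_prod :: "'a \<times> 'b \<Rightarrow> 'a \<times> 'b \<Rightarrow> 'a \<times> 'b"
  where "lie_prod x y = (lie (fst x) (fst y), lie (snd x) (snd y))"

instance
  by standard
    (auto simp: lie_prod_def prod_eq_iff lie_add_left lie_scaleR_left lie_add_right
      lie_scaleR_right lie_self lie_jacobi)

end

definition lie_automorphism :: "('a::real_lie_algebra \<Rightarrow> 'a) \<Rightarrow> bool"
  where "lie_automorphism f \<longleftrightarrow>
    linear f \<and> bij f \<and> (\<forall>x y. f (lie x y) = lie (f x) (f y))"


section \<open>The Lie algebra of traceless skew-Hermitian matrices\<close>

definition adjoint_matrix :: "complex^'n^'m \<Rightarrow> complex^'m^'n"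
  where "adjoint_matrix A = (\<chi> i j. cnj (A $ j $ i))"

typedef su2 = "{A :: complex^2^2. adjoint_matrix A = - A \<and> trace A = 0}"
  by (rule exI[of _ 0]) (simp add: adjoint_matrix_def vec_eq_iff trace_def)

setup_lifting type_definition_su2

instantiation su2 :: real_lie_algebra
begin

lift_definition zero_su2 :: su2 is 0
  by (simp add: adjoint_matrix_def vec_eq_iff trace_def)

lift_definition plus_su2 :: "su2 \<Rightarrow> su2 \<Rightarrow> su2" is "(+)"
  by (auto simp: adjoint_matrix_def vec_eq_iff trace_add)

lift_definition minus_su2 :: "su2 \<Rightarrow> su2 \<Rightarrow> su2" is "(-)"
  by (auto simp: adjoint_matrix_def vec_eq_iff trace_sub)

lift_definition uminus_su2 :: "su2 \<Rightarrow> su2" is uminus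
  by (auto simp: adjoint_matrix_def vec_eq_iff trace_def sum_negf)

lift_definition scaleR_su2 :: "real \<Rightarrow> su2 \<Rightarrow> su2" is scaleR
  by (auto simp: adjoint_matrix_def vec_eq_iff trace_def simp flip: scaleR_sum_right)

lift_definition lie_su2 :: "su2 \<Rightarrow> su2 \<Rightarrow> su2" is "\<lambda>A B. A ** B - B ** A"
proof (intro conjI)
  fix A B :: "complex^2^2"
  assume A: "adjoint_matrix A = - A \<and> trace A = 0"
    and B: "adjoint_matrix B = - B \<and> trace B = 0"
  have mult: "adjoint_matrix (C ** D) = adjoint_matrix D ** adjoint_matrix C"
    for C D :: "complex^2^2"
    by (simp add: adjoint_matrix_def vec_eq_iff matrix_matrix_mult_def mult.commute)
  have diff: "adjoint_matrix (C - D) = adjoint_matrix C - adjoint_matrix D"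
    for C D :: "complex^2^2"
    by (simp add: adjoint_matrix_def vec_eq_iff)
  have neg: "(- C) ** (- D) = C ** D" for C D :: "complex^2^2"
    by (simp add: vec_eq_iff matrix_matrix_mult_def)
  show "adjoint_matrix (A ** B - B ** A) = - (A ** B - B ** A)"
    using A B by (simp add: mult diff neg)
  show "trace (A ** B - B ** A) = 0"
    by (simp add: trace_sub trace_mul_sym[of A B])
qed

instance
proof
  fix x y z :: su2 and a b :: real
  show "x + y + z = x + (y + z)" by transfer (simp add: algebra_simps)
  show "x + y = y + x" by transfer (simp add: algebra_simps)
  show "0 + x = x" by transfer simp
  show "- x + x = 0" by transfer simp
  show "x - y = x + - y" by transfer simp
  show "a *\<^sub>R (x + y) = a *\<^sub>R x + a *\<^sub>R y" by transfer (simp add: algebra_simps)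
  show "(a + b) *\<^sub>R x = a *\<^sub>R x + b *\<^sub>R x" by transfer (simp add: algebra_simps)
  show "a *\<^sub>R b *\<^sub>R x = (a * b) *\<^sub>R x" by transfer simp
  show "1 *\<^sub>R x = x" by transfer simp
  show "lie (x + y) z = lie x z + lie y z"
    by transfer (simp add: vec_eq_iff matrix_matrix_mult_def sum_2 algebra_simps)
  show "lie (a *\<^sub>R x) z = a *\<^sub>R lie x z"
    by transfer (simp add: vec_eq_iff matrix_matrix_mult_def sum_2 algebra_simps)
  show "lie z (x + y) = lie z x + lie z y"
    by transfer (simp add: vec_eq_iff matrix_matrix_mult_def sum_2 algebra_simps)
  show "lie z (a *\<^sub>R x) = a *\<^sub>R lie z x"
    by transfer (simp add: vec_eq_iff matrix_matrix_mult_def sum_2 algebra_simps)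
  show "lie x x = 0" by transfer simp
  show "lie x (lie y z) + lie y (lie z x) + lie z (lie x y) = 0"
    by transfer (simp add: vec_eq_iff matrix_matrix_mult_def sum_2 algebra_simps)
qed

end

definition su2_standard_basis :: "su2 \<Rightarrow> su2 \<Rightarrow> su2 \<Rightarrow> bool"
  where "su2_standard_basis e1 e2 e3 \<longleftrightarrow>
    independent {e1, e2, e3} \<and> span {e1, e2, e3} = UNIV \<and>
    lie e1 e2 = - e3 \<and> lie e1 e3 = e2 \<and> lie e2 e3 = - e1"

text \<open>Such a basis exists: multiply the Pauli matrices by half the imaginary unit.\<close>

lemma su2_standard_basis_exists: "\<exists>e1 e2 e3. su2_standard_basis e1 e2 e3"
proof -
  define m1 :: "complex^2^2" where "m1 = vector [vector [0, \<i>/2], vector [\<i>/2, 0]]"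
  define m2 :: "complex^2^2" where "m2 = vector [vector [0, 1/2], vector [-1/2, 0]]"
  define m3 :: "complex^2^2" where "m3 = vector [vector [\<i>/2, 0], vector [0, -\<i>/2]]"
  define e1 e2 e3 where e_defs: "e1 = Abs_su2 m1" "e2 = Abs_su2 m2" "e3 = Abs_su2 m3"
  have Rep: "Rep_su2 e1 = m1" "Rep_su2 e2 = m2" "Rep_su2 e3 = m3"
    unfolding e_defs
    by (subst Abs_su2_inverse;
        simp add: adjoint_matrix_def trace_def m1_def m2_def m3_def vec_eq_iff forall_2 sum_2)+
  have coords: "Rep_su2 (a *\<^sub>R e1 + b *\<^sub>R e2 + c *\<^sub>R e3) = a *\<^sub>R m1 + b *\<^sub>R m2 + c *\<^sub>R m3" for a b c
    by (simp add: plus_su2.rep_eq scaleR_su2.rep_eq Rep)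
  have eq0: "a = 0 \<and> b = 0 \<and> c = 0" if "a *\<^sub>R e1 + b *\<^sub>R e2 + c *\<^sub>R e3 = 0" for a b c
  proof -
    have "a *\<^sub>R m1 + b *\<^sub>R m2 + c *\<^sub>R m3 = 0"
      using that coords[of a b c] by (simp add: zero_su2.rep_eq)
    then show ?thesis
      by (simp add: m1_def m2_def m3_def vec_eq_iff forall_2 complex_eq_iff)
  qed
  have spn: "v \<in> span {e1, e2, e3}" for v
  proof -
    define R where "R = Rep_su2 v"
    have R: "cnj (R $ j $ i) = - (R $ i $ j)" "R $ 1 $ 1 + R $ 2 $ 2 = 0" for i j
      using Rep_su2[of v]
      by (auto simp: R_def adjoint_matrix_def vec_eq_iff trace_def sum_2)
    have "Re (R $ 1 $ 1) = 0" "Re (R $ 2 $ 2) = 0" "Im (R $ 2 $ 2) = - Im (R $ 1 $ 1)"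
      "Re (R $ 2 $ 1) = - Re (R $ 1 $ 2)" "Im (R $ 2 $ 1) = Im (R $ 1 $ 2)"
      using R(1)[of 1 1] R(1)[of 2 2] R(1)[of 1 2] R(2) by (simp_all add: complex_eq_iff)
    then have "R = (2 * Im (R $ 1 $ 2)) *\<^sub>R m1 + (2 * Re (R $ 1 $ 2)) *\<^sub>R m2
        + (2 * Im (R $ 1 $ 1)) *\<^sub>R m3"
      by (simp add: m1_def m2_def m3_def vec_eq_iff forall_2 complex_eq_iff)
    then have "\<exists>a b c. Rep_su2 v = a *\<^sub>R m1 + b *\<^sub>R m2 + c *\<^sub>R m3"
      unfolding R_def by blast
    then obtain a b c where "v = a *\<^sub>R e1 + b *\<^sub>R e2 + c *\<^sub>R e3"
      using coords Rep_su2_inject by metis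
    then show ?thesis
      by (simp add: span_add span_mul span_base)
  qed
  have brackets: "lie e1 e2 = - e3" "lie e1 e3 = e2" "lie e2 e3 = - e1"
    by (simp_all add: Rep_su2_inject[symmetric] lie_su2.rep_eq uminus_su2.rep_eq Rep m1_def m2_def
        m3_def vec_eq_iff forall_2 matrix_matrix_mult_def sum_2)
  have ne: "e1 \<noteq> e2" "e1 \<noteq> e3" "e2 \<noteq> e3"
    using eq0[of 1 "-1" 0] eq0[of 1 0 "-1"] eq0[of 0 1 "-1"] by auto
  have "independent {e1, e2, e3}"
    using ne eq0 by (auto simp: dependent_finite add.assoc)
  then show ?thesis
    unfolding su2_standard_basis_def using spn brackets by blast
qed


section \<open>Low-degree exterior forms and the Chevalley--Eilenberg differential\<close>

text \<open>A form of degree \<open>k\<close> is a curried alternating multilinear function of \<open>k\<close> arguments.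
  Wedge products are sums over shuffles (no normalising factor), so that the wedge of covectors
  \<open>\<alpha>\<close> and \<open>\<beta>\<close> is \<open>\<alpha> x * \<beta> y - \<alpha> y * \<beta> x\<close>. A name ending in \<open>pq\<close> is the product of a
  \<open>p\<close>-form and a \<open>q\<close>-form.\<close>

definition form1 :: "('a::real_vector \<Rightarrow> real) \<Rightarrow> bool"
  where "form1 \<alpha> \<longleftrightarrow> linear \<alpha>"

definition form2 :: "('a::real_vector \<Rightarrow> 'a \<Rightarrow> real) \<Rightarrow> bool"
  where "form2 \<omega> \<longleftrightarrow> bilinear \<omega> \<and> (\<forall>x. \<omega> x x = 0)"

definition wedge11 :: "('a \<Rightarrow> real) \<Rightarrow> ('a \<Rightarrow> real) \<Rightarrow> 'a \<Rightarrow> 'a \<Rightarrow> real"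
  where "wedge11 \<alpha> \<beta> = (\<lambda>x y. \<alpha> x * \<beta> y - \<alpha> y * \<beta> x)"

definition wedge12 :: "('a \<Rightarrow> real) \<Rightarrow> ('a \<Rightarrow> 'a \<Rightarrow> real) \<Rightarrow> 'a \<Rightarrow> 'a \<Rightarrow> 'a \<Rightarrow> real"
  where "wedge12 \<alpha> \<omega> = (\<lambda>x y z. \<alpha> x * \<omega> y z - \<alpha> y * \<omega> x z + \<alpha> z * \<omega> x y)"

definition wedge22 ::
    "('a \<Rightarrow> 'a \<Rightarrow> real) \<Rightarrow> ('a \<Rightarrow> 'a \<Rightarrow> real) \<Rightarrow> 'a \<Rightarrow> 'a \<Rightarrow> 'a \<Rightarrow> 'a \<Rightarrow> real"
  where "wedge22 \<omega> \<eta> = (\<lambda>x y z w.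
      \<omega> x y * \<eta> z w - \<omega> x z * \<eta> y w + \<omega> x w * \<eta> y z
    + \<omega> y z * \<eta> x w - \<omega> y w * \<eta> x z + \<omega> z w * \<eta> x y)"

text \<open>The differential with trivial coefficients,
  \<open>(d \<omega>) (x\<^sub>0, \<dots>, x\<^sub>k) = (\<Sum>i<j. (-1)^(i+j) \<omega> ([x\<^sub>i, x\<^sub>j], x\<^sub>0, \<dots>, x\<^sub>k))\<close>
  with \<open>x\<^sub>i\<close> and \<open>x\<^sub>j\<close> omitted from the tail, in degrees one and two.\<close>

definition ce_d1 :: "('a::real_lie_algebra \<Rightarrow> real) \<Rightarrow> 'a \<Rightarrow> 'a \<Rightarrow> real"
  where "ce_d1 \<alpha> = (\<lambda>x y. - \<alpha> (lie x y))"

definition ce_d2 :: "('a::real_lie_algebra \<Rightarrow> 'a \<Rightarrow> real) \<Rightarrow> 'a \<Rightarrow> 'a \<Rightarrow> 'a \<Rightarrow> real"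
  where "ce_d2 \<omega> = (\<lambda>x y z. - \<omega> (lie x y) z + \<omega> (lie x z) y - \<omega> (lie y z) x)"


section \<open>Locally conformally symplectic structures\<close>

text \<open>The condition on \<open>wedge22 \<Omega> \<Omega>\<close> is nondegeneracy only in dimension four, so the following
  two notions are meant for four-dimensional Lie algebras.\<close>

definition lcs_structure ::
    "('a::real_lie_algebra \<Rightarrow> 'a \<Rightarrow> real) \<times> ('a \<Rightarrow> real) \<Rightarrow> bool"
  where "lcs_structure = (\<lambda>(\<Omega>, \<theta>). form2 \<Omega> \<and> form1 \<theta> \<and>
    wedge22 \<Omega> \<Omega> \<noteq> (\<lambda>x y z w. 0) \<and>
    ce_d1 \<theta> = (\<lambda>x y. 0) \<and>
    ce_d2 \<Omega> = wedge12 \<theta> \<Omega>)"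

definition pullback ::
    "('a \<Rightarrow> 'a) \<Rightarrow> ('a \<Rightarrow> 'a \<Rightarrow> real) \<times> ('a \<Rightarrow> real) \<Rightarrow> ('a \<Rightarrow> 'a \<Rightarrow> real) \<times> ('a \<Rightarrow> real)"
  where "pullback f = (\<lambda>(\<Omega>, \<theta>). (\<lambda>x y. \<Omega> (f x) (f y), \<lambda>x. \<theta> (f x)))"

definition lcs_equivalent ::
    "('a::real_lie_algebra \<Rightarrow> 'a \<Rightarrow> real) \<times> ('a \<Rightarrow> real) \<Rightarrow>
     ('a \<Rightarrow> 'a \<Rightarrow> real) \<times> ('a \<Rightarrow> real) \<Rightarrow> bool"
  where "lcs_equivalent S T \<longleftrightarrow> lcs_structure S \<and> lcs_structure T \<and>
    (\<exists>f. lie_automorphism f \<and> pullback f S = T)"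

definition dual_basis ::
    "('i \<Rightarrow> 'a::real_vector) \<Rightarrow> 'i set \<Rightarrow> ('i \<Rightarrow> 'a \<Rightarrow> real) \<Rightarrow> bool"
  where "dual_basis e I \<epsilon> \<longleftrightarrow> (\<forall>i\<in>I. form1 (\<epsilon> i)) \<and>
    (\<forall>i\<in>I. \<forall>j\<in>I. \<epsilon> i (e j) = (if i = j then 1 else 0))"

end

theory Submission
  imports Defs
begin

unbundle cross3_syntax

text \<open>Write \<open>\<theta>(x, s) = c s\<close>, which holds because \<open>su2\<close> is perfect. Evaluating \<open>d\<Omega> = \<theta> \<and> \<Omega>\<close>
  on \<open>(x, y, (0, 1))\<close> gives \<open>\<Omega>([x, y], (0, 1)) = - c \<Omega>(x, y)\<close>. If \<open>c = 0\<close>, then \<open>\<Omega>\<close> lives on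
  the three-dimensional factor and \<open>\<Omega>\<^sup>2 = 0\<close>; otherwise \<open>\<Omega> = d\<alpha> - \<theta> \<and> \<alpha>\<close> with
  \<open>\<alpha> = \<Omega>(\<cdot>, (0, 1)) / c \<noteq> 0\<close>. As the bracket of \<open>su2\<close> is minus the cross product, rotations are
  automorphisms, so \<open>\<alpha>\<close> can be turned into \<open>r e\<^sup>3\<close>, and \<open>\<theta>\<close> into \<open>e\<^sup>4\<close> by rescaling the line.\<close>

section \<open>Coordinates in \<open>real^3\<close> with respect to three vectors\<close>

definition comb3 :: "'a::real_vector \<Rightarrow> 'a \<Rightarrow> 'a \<Rightarrow> real^3 \<Rightarrow> 'a"
  where "comb3 u1 u2 u3 v = v $ 1 *\<^sub>R u1 + v $ 2 *\<^sub>R u2 + v $ 3 *\<^sub>R u3"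

lemma linear_comb3: "linear (comb3 u1 u2 u3)"
  by (rule linearI) (simp_all add: comb3_def algebra_simps)

lemma linear_compose_comb3:
  fixes \<alpha> :: "'a::real_vector \<Rightarrow> real"
  assumes "linear \<alpha>"
  shows "\<alpha> (comb3 u1 u2 u3 v) = vector [\<alpha> u1, \<alpha> u2, \<alpha> u3] \<bullet> v"
  by (simp add: comb3_def linear_add[OF assms] linear_scale[OF assms] inner_vec_def sum_3)

lemma surj_comb3:
  assumes "span {u1, u2, u3} = UNIV"
  shows "surj (comb3 u1 u2 u3)"
  unfolding surj_def
proof
  fix x
  have "x \<in> span {u1, u2, u3}" using assms by simp
  then obtain a b c where "x - a *\<^sub>R u1 - b *\<^sub>R u2 - c *\<^sub>R u3 = 0"
    by (auto simp: span_breakdown_eq)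
  then have "x = comb3 u1 u2 u3 (vector [a, b, c])"
    by (simp add: comb3_def algebra_simps)
  then show "\<exists>v. x = comb3 u1 u2 u3 v" ..
qed

text \<open>Independence concerns a set, which would silently merge repeated vectors, so
  distinctness is assumed separately.\<close>

lemma inj_comb3:
  assumes "independent {u1, u2, u3}" "u1 \<noteq> u2" "u1 \<noteq> u3" "u2 \<noteq> u3"
  shows "inj (comb3 u1 u2 u3)"
  unfolding linear_injective_0[OF linear_comb3]
proof (intro allI impI)
  fix v :: "real^3"
  assume v: "comb3 u1 u2 u3 v = 0"
  define k where "k x = (if x = u1 then v $ 1 else if x = u2 then v $ 2 else v $ 3)" for x
  have "(\<Sum>x\<in>{u1, u2, u3}. k x *\<^sub>R x) = 0"
    using v assms(2-4) by (simp add: k_def comb3_def add.assoc)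
  then have "k u1 = 0" "k u2 = 0" "k u3 = 0"
    using independentD[OF assms(1), of "{u1, u2, u3}" k] by auto
  then show "v = 0"
    using assms(2-4) by (simp add: k_def vec_eq_iff forall_3)
qed

section \<open>Skew-symmetry, and 2-forms in three coordinates\<close>

lemma lie_zero_right: "lie y 0 = (0 :: 'a::real_lie_algebra)"
  using lie_scaleR_right[of y 0 0] by simp

lemma lie_skew: "lie y x = - lie x (y :: 'a::real_lie_algebra)"
proof -
  have "lie x y + lie y x = 0"
    using lie_self[of "x + y"]
    by (simp add: lie_add_left lie_add_right lie_self[of x] lie_self[of y] add.commute)
  then show ?thesis
    by (simp add: add_eq_0_iff)
qed

lemma form2_skew:
  assumes "form2 \<omega>"
  shows "\<omega> y x = - \<omega> x y"
proof -
  have b: "bilinear \<omega>" and z: "\<omega> v v = 0" for v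
    using assms by (auto simp: form2_def)
  show ?thesis
    using z[of "x + y"] by (simp add: bilinear_ladd[OF b] bilinear_radd[OF b] z[of x] z[of y])
qed

lemma form2_compose:
  assumes "linear f" "form2 \<omega>"
  shows "form2 (\<lambda>x y. \<omega> (f x) (f y))"
  using assms(2) linear_compose[OF assms(1)]
  by (auto simp: form2_def bilinear_def o_def simp del: split_paired_All)

text \<open>Hodge duality in dimension three: the coefficients of a 2-form make up a vector that is
  paired with the cross product.\<close>

lemma form2_comb3:
  assumes "form2 \<omega>"
  shows "\<omega> (comb3 u1 u2 u3 v) (comb3 u1 u2 u3 w)
    = vector [\<omega> u2 u3, - \<omega> u1 u3, \<omega> u1 u2] \<bullet> (v \<times> w)"
proof -
  have b: "bilinear \<omega>" and z: "\<omega> x x = 0" for x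
    using assms by (auto simp: form2_def)
  have s: "\<omega> u2 u1 = - \<omega> u1 u2" "\<omega> u3 u1 = - \<omega> u1 u3" "\<omega> u3 u2 = - \<omega> u2 u3"
    using form2_skew[OF assms] by blast+
  show ?thesis
    by (simp add: comb3_def bilinear_ladd[OF b] bilinear_radd[OF b] bilinear_lmul[OF b]
        bilinear_rmul[OF b] z s inner_vec_def sum_3 cross_components algebra_simps)
qed

text \<open>For \<omega>(v, w) = b \<bullet> (v \<times> w) the left side is half of \<omega> \<and>
  \<omega>, a 4-form on a three-dimensional space.\<close>

lemma triple_product_Pluecker:
  fixes b v w x y :: "real^3"
  shows "(b \<bullet> (v \<times> w)) * (b \<bullet> (x \<times> y)) - (b \<bullet> (v \<times> x)) * (b \<bullet> (w \<times> y))
    + (b \<bullet> (v \<times> y)) * (b \<bullet> (w \<times> x)) = 0"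
  by (simp add: inner_vec_def sum_3 cross_components algebra_simps)

lemma wedge22_self_eq_0:
  fixes \<omega> :: "'a::real_vector \<Rightarrow> 'a \<Rightarrow> real" and u1 u2 u3 :: 'a
  assumes "form2 \<omega>" "surj (comb3 u1 u2 u3)"
  shows "wedge22 \<omega> \<omega> x y z w = 0"
proof -
  define b :: "real^3" where "b = vector [\<omega> u2 u3, - \<omega> u1 u3, \<omega> u1 u2]"
  obtain x' y' z' w' where "x = comb3 u1 u2 u3 x'" "y = comb3 u1 u2 u3 y'"
    "z = comb3 u1 u2 u3 z'" "w = comb3 u1 u2 u3 w'"
    using surjD[OF assms(2)] by meson
  then show ?thesis
    using triple_product_Pluecker[of b x' y' z' w']
    by (simp add: wedge22_def form2_comb3[OF assms(1)] mult.commute flip: b_def)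
qed

section \<open>The bracket of su(2) and its automorphisms\<close>

lemma su2_standard_basis_bij_comb3:
  assumes "su2_standard_basis u1 u2 u3"
  shows "bij (comb3 u1 u2 u3)"
proof -
  have ind: "independent {u1, u2, u3}" and spn: "span {u1, u2, u3} = UNIV"
    and br: "lie u1 u2 = - u3" "lie u1 u3 = u2" "lie u2 u3 = - u1"
    using assms by (auto simp: su2_standard_basis_def)
  have nz: "u1 \<noteq> 0" "u2 \<noteq> 0" "u3 \<noteq> 0"
    using ind dependent_zero[of "{u1, u2, u3}"] by auto
  \<comment> \<open>If two of the vectors agreed, their bracket would vanish, but it is the third
    vector up to sign.\<close>
  have "u1 \<noteq> u2" "u1 \<noteq> u3" "u2 \<noteq> u3"
    using br nz by (auto simp: lie_self)
  with ind spn show ?thesis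
    by (simp add: bij_def inj_comb3 surj_comb3)
qed

lemma su2_standard_basis_lie_comb3:
  assumes "su2_standard_basis u1 u2 u3"
  shows "lie (comb3 u1 u2 u3 v) (comb3 u1 u2 u3 w) = - comb3 u1 u2 u3 (v \<times> w)"
proof -
  have br: "lie u1 u2 = - u3" "lie u1 u3 = u2" "lie u2 u3 = - u1"
    using assms by (auto simp: su2_standard_basis_def)
  have br': "lie u2 u1 = u3" "lie u3 u1 = - u2" "lie u3 u2 = u1"
    using br lie_skew[of u2 u1] lie_skew[of u3 u1] lie_skew[of u3 u2] by auto
  show ?thesis
    by (simp add: comb3_def lie_add_left lie_add_right lie_scaleR_left lie_scaleR_right lie_self
        br br' cross_components algebra_simps)
qed

text \<open>Each vector of a standard basis is a bracket up to sign, so a functional that kills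
  brackets vanishes on a spanning set.\<close>

lemma su2_perfect:
  fixes \<phi> :: "su2 \<Rightarrow> real"
  assumes "linear \<phi>" "\<And>x y. \<phi> (lie x y) = 0"
  shows "\<phi> x = 0"
proof -
  obtain u1 u2 u3 where u: "su2_standard_basis u1 u2 u3"
    using su2_standard_basis_exists by blast
  then have br: "lie u1 u2 = - u3" "lie u1 u3 = u2" "lie u2 u3 = - u1"
    and spn: "span {u1, u2, u3} = UNIV"
    by (auto simp: su2_standard_basis_def)
  have "\<phi> u1 = 0" "\<phi> u2 = 0" "\<phi> u3 = 0"
    using assms(2)[of u1 u2] assms(2)[of u1 u3] assms(2)[of u2 u3]
    by (simp_all add: br linear_neg[OF assms(1)])
  then show ?thesis
    using linear_eq_0_on_span[OF assms(1), of "{u1, u2, u3}" x] spn by auto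
qed

text \<open>The automorphism is a rotation read in coordinates; it carries r times the third axis to
  the vector representing \<alpha>, where r is the length of that vector.\<close>

lemma su2_automorphism_to_third_coordinate:
  fixes \<alpha> :: "su2 \<Rightarrow> real"
  assumes u: "su2_standard_basis u1 u2 u3" and \<alpha>: "linear \<alpha>" "\<alpha> x0 \<noteq> 0"
  obtains g r where "lie_automorphism g" "r > 0"
    "\<And>v. \<alpha> (g (comb3 u1 u2 u3 v)) = r * v $ 3"
proof -
  let ?K = "comb3 u1 u2 u3"
  have K: "linear ?K" "bij ?K"
    using u by (simp_all add: linear_comb3 su2_standard_basis_bij_comb3)
  define a :: "real^3" where "a = vector [\<alpha> u1, \<alpha> u2, \<alpha> u3]"
  have a: "\<alpha> (?K v) = a \<bullet> v" for v
    by (simp add: a_def linear_compose_comb3[OF \<alpha>(1)])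
  have "a \<noteq> 0"
  proof
    assume "a = 0"
    then have "\<alpha> x0 = 0"
      using surjD[OF bij_is_surj[OF K(2)], of x0] by (auto simp: a)
    with \<alpha>(2) show False ..
  qed
  define r where "r = norm a"
  have "norm (axis 3 r :: real^3) = norm a"
    by (simp add: r_def norm_eq_sqrt_inner inner_axis_axis)
  then obtain R :: "real^3 \<Rightarrow> real^3" where R: "orthogonal_transformation R" "det (matrix R) = 1"
      "R (axis 3 r) = a"
    using rotation_exists[of "axis 3 r" a] by auto
  define L where "L = inv ?K"
  have LK: "L (?K v) = v" for v
    using K(2) by (simp add: L_def bij_is_inj)
  have KL: "?K (L x) = x" for x
    using K(2) by (simp add: L_def bij_is_surj surj_f_inv_f)
  have L: "linear L"
  proof (rule linearI)
    show "L (x + y) = L x + L y" for x y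
      using LK[of "L x + L y"] by (simp add: linear_add[OF K(1)] KL)
    show "L (c *\<^sub>R x) = c *\<^sub>R L x" for c x
      using LK[of "c *\<^sub>R L x"] by (simp add: linear_scale[OF K(1)] KL)
  qed
  define g where "g = ?K \<circ> R \<circ> L"
  have gK: "g (?K v) = ?K (R v)" for v
    by (simp add: g_def LK)
  show thesis
  proof
    have "linear g"
      unfolding g_def using K L R(1) by (intro linear_compose) (auto simp: orthogonal_transformation_linear)
    moreover have "bij g"
      unfolding g_def L_def using K(2) R(1)
      by (intro bij_comp bij_imp_bij_inv) (auto simp: orthogonal_transformation_bij)
    \<comment> \<open>An orthogonal map respects the cross product only up to its determinant, so
      determinant 1 is essential.\<close>
    moreover have "g (lie (?K v) (?K w)) = lie (g (?K v)) (g (?K w))" for v w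
      by (simp add: gK su2_standard_basis_lie_comb3[OF u] cross_orthogonal_transformation[OF R(1)]
          R(2) linear_neg[OF \<open>linear g\<close>])
    from this[of "L x" "L y" for x y] have "g (lie x y) = lie (g x) (g y)" for x y
      by (simp only: KL)
    ultimately show "lie_automorphism g"
      by (simp add: lie_automorphism_def)
    show "r > 0"
      using \<open>a \<noteq> 0\<close> by (simp add: r_def)
    show "\<alpha> (g (?K v)) = r * v $ 3" for v
    proof -
      have "\<alpha> (g (?K v)) = R (axis 3 r) \<bullet> R v"
        by (simp add: gK a R(3))
      also have "\<dots> = axis 3 r \<bullet> v"
        using R(1) by (simp add: orthogonal_transformation_def)
      finally show ?thesis
        by (simp add: inner_axis')
    qed
  qed
qed

section \<open>Pullbacks of lcs structures, and their shape on su(2) plus a line\<close>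

lemma lcs_structure_pullback:
  assumes f: "lie_automorphism f" and S: "lcs_structure (\<Omega>, \<theta>)"
  shows "lcs_structure (pullback f (\<Omega>, \<theta>))"
proof -
  have lf: "linear f" and sf: "surj f" and hf: "f (lie x y) = lie (f x) (f y)" for x y
    using f by (auto simp: lie_automorphism_def bij_is_surj)
  have F: "form2 \<Omega>" and l\<theta>: "linear \<theta>"
    and nd: "wedge22 \<Omega> \<Omega> \<noteq> (\<lambda>x y z w. 0)" and cl: "ce_d1 \<theta> = (\<lambda>x y. 0)"
    and lcs: "ce_d2 \<Omega> = wedge12 \<theta> \<Omega>"
    using S by (auto simp: lcs_structure_def form1_def)
  have "form2 (\<lambda>x y. \<Omega> (f x) (f y))"
    by (rule form2_compose[OF lf F])
  moreover have "form1 (\<lambda>x. \<theta> (f x))"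
    using linear_compose[OF lf l\<theta>] by (simp add: form1_def o_def)
  \<comment> \<open>Arguments where \<Omega> \<and> \<Omega> is nonzero lie in the image of
    \<open>f\<close>, which is onto.\<close>
  moreover obtain x y z w where "wedge22 \<Omega> \<Omega> (f x) (f y) (f z) (f w) \<noteq> 0"
    using nd sf by (metis (no_types) surj_def)
  then have "wedge22 (\<lambda>x y. \<Omega> (f x) (f y)) (\<lambda>x y. \<Omega> (f x) (f y)) x y z w \<noteq> 0"
    by (simp add: wedge22_def)
  then have "wedge22 (\<lambda>x y. \<Omega> (f x) (f y)) (\<lambda>x y. \<Omega> (f x) (f y)) \<noteq> (\<lambda>x y z w. 0)"
    by metis
  moreover have "ce_d1 (\<lambda>x. \<theta> (f x)) = (\<lambda>x y. 0)"
    using cl by (simp add: ce_d1_def hf fun_eq_iff)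
  moreover have "ce_d2 (\<lambda>x y. \<Omega> (f x) (f y)) = wedge12 (\<lambda>x. \<theta> (f x)) (\<lambda>x y. \<Omega> (f x) (f y))"
    using lcs by (simp add: ce_d2_def wedge12_def hf fun_eq_iff)
  ultimately show ?thesis
    by (simp add: lcs_structure_def pullback_def)
qed

text \<open>The last formula is \<Omega> = d\<alpha> - \<theta> \<and> \<alpha> evaluated on pairs,
  with \<alpha> extended by zero to the line.\<close>

lemma lcs_structure_su2_real_primitive:
  fixes \<Omega> :: "su2 \<times> real \<Rightarrow> su2 \<times> real \<Rightarrow> real"
  assumes "lcs_structure (\<Omega>, \<theta>)"
  obtains c \<alpha> x0 where "c \<noteq> 0" "linear \<alpha>" "\<alpha> x0 \<noteq> (0::real)" "\<And>x s. \<theta> (x, s) = c * s"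
    "\<And>x s y s'. \<Omega> (x, s) (y, s') = - \<alpha> (lie x y) + c * (\<alpha> x * s' - \<alpha> y * s)"
proof -
  have F: "form2 \<Omega>" and b: "bilinear \<Omega>" and alt: "\<Omega> X X = 0" and l\<theta>: "linear \<theta>"
    and nd: "wedge22 \<Omega> \<Omega> \<noteq> (\<lambda>x y z w. 0)" and cl: "ce_d1 \<theta> = (\<lambda>x y. 0)"
    and lcs: "ce_d2 \<Omega> = wedge12 \<theta> \<Omega>" for X
    using assms by (auto simp: lcs_structure_def form2_def form1_def simp del: split_paired_All)
  define i :: "su2 \<Rightarrow> su2 \<times> real" where "i x = (x, 0)" for x
  define T :: "su2 \<times> real" where "T = (0, 1)"
  define c where "c = \<theta> T"
  have li: "linear i"
    by (rule linearI) (simp_all add: i_def)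
  have dec: "(x, s) = i x + s *\<^sub>R T" for x s
    by (simp add: i_def T_def)
  have lie_i: "lie (i x) (i y) = i (lie x y)" "lie (i x) T = 0" for x y
    by (simp_all add: i_def T_def lie_prod_def lie_real_def lie_zero_right zero_prod_def)
  have "\<theta> (i (lie x y)) = 0" for x y
    using fun_cong[OF fun_cong[OF cl, of "i x"], of "i y"] by (simp add: ce_d1_def lie_i)
  then have \<theta>i: "\<theta> (i x) = 0" for x
    using su2_perfect[of "\<theta> \<circ> i"] linear_compose[OF li l\<theta>] by simp
  have \<theta>: "\<theta> (x, s) = c * s" for x s
    by (simp add: dec linear_add[OF l\<theta>] linear_scale[OF l\<theta>] \<theta>i c_def)
  define \<beta> where "\<beta> x = \<Omega> (i x) T" for x
  have "linear (\<lambda>X. \<Omega> X T)"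
    using b unfolding bilinear_def by blast
  from linear_compose[OF li this] have l\<beta>: "linear \<beta>"
    by (simp add: \<beta>_def[abs_def] o_def)
  \<comment> \<open>\<open>T\<close> is central and \<theta> vanishes on su(2), so each side keeps a
    single term.\<close>
  have \<beta>: "\<beta> (lie x y) = - c * \<Omega> (i x) (i y)" for x y
    using fun_cong[OF fun_cong[OF fun_cong[OF lcs, of "i x"], of "i y"], of T]
    by (simp add: ce_d2_def wedge12_def lie_i \<beta>_def \<theta>i bilinear_lzero[OF b] flip: c_def)
  have \<Omega>: "\<Omega> (x, s) (y, s') = \<Omega> (i x) (i y) + \<beta> x * s' - \<beta> y * s" for x s y s'
    by (simp add: dec bilinear_ladd[OF b] bilinear_radd[OF b] bilinear_lmul[OF b]
        bilinear_rmul[OF b] alt \<beta>_def form2_skew[OF F, of T])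
  obtain u1 u2 u3 where u: "su2_standard_basis u1 u2 u3"
    using su2_standard_basis_exists by blast
  have "c \<noteq> 0"
  proof
    assume "c = 0"
    \<comment> \<open>With c = 0 the relation above makes \<beta> vanish on brackets, so \<Omega>
      ignores the line.\<close>
    then have "\<beta> x = 0" for x
      using su2_perfect[OF l\<beta>] \<beta> by simp
    then have red: "\<Omega> X Y = \<Omega> (i (fst X)) (i (fst Y))" for X Y
      using \<Omega>[of "fst X" "snd X" "fst Y" "snd Y"] by simp
    have "form2 (\<lambda>x y. \<Omega> (i x) (i y))"
      by (rule form2_compose[OF li F])
    then have "wedge22 (\<lambda>x y. \<Omega> (i x) (i y)) (\<lambda>x y. \<Omega> (i x) (i y)) x y z w = 0" for x y z w
      using wedge22_self_eq_0 su2_standard_basis_bij_comb3[OF u] bij_is_surj by blast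
    then have "wedge22 \<Omega> \<Omega> X Y Z W = 0" for X Y Z W
      \<comment> \<open>The right side of \<open>red\<close> again matches its left side, so each of
        the twelve factors is rewritten exactly once.\<close>
      unfolding wedge22_def by (subst (1 2 3 4 5 6 7 8 9 10 11 12) red) simp
    with nd show False by blast
  qed
  define \<alpha> where "\<alpha> x = \<beta> x / c" for x
  show thesis
  proof
    show "c \<noteq> 0" by fact
    show "\<theta> (x, s) = c * s" for x s by (fact \<theta>)
    show "linear \<alpha>"
      by (rule linearI) (simp_all add: \<alpha>_def linear_add[OF l\<beta>] linear_scale[OF l\<beta>] add_divide_distrib)
    show *: "\<Omega> (x, s) (y, s') = - \<alpha> (lie x y) + c * (\<alpha> x * s' - \<alpha> y * s)" for x s y s'
      using \<open>c \<noteq> 0\<close> by (simp add: \<Omega> \<alpha>_def \<beta> algebra_simps)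
    \<comment> \<open>Were \<alpha> zero, \<Omega> would be zero and so would its square.\<close>
    have "\<exists>x0. \<alpha> x0 \<noteq> 0"
    proof (rule ccontr)
      assume "\<nexists>x0. \<alpha> x0 \<noteq> 0"
      then have "\<Omega> X Y = 0" for X Y
        using *[of "fst X" "snd X" "fst Y" "snd Y"] by simp
      with nd show False by (simp add: wedge22_def)
    qed
    then show "\<alpha> (SOME x. \<alpha> x \<noteq> 0) \<noteq> 0"
      by (rule someI_ex)
  qed
qed

section \<open>Reduction to the normal form\<close>

theorem proposition3p4:
  fixes e :: "nat \<Rightarrow> su2 \<times> real"
    and \<epsilon> :: "nat \<Rightarrow> su2 \<times> real \<Rightarrow> real"
    and u1 u2 u3 :: su2 and t :: real
    and \<Omega> :: "su2 \<times> real \<Rightarrow> su2 \<times> real \<Rightarrow> real"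
    and \<theta> :: "su2 \<times> real \<Rightarrow> real"
  assumes "su2_standard_basis u1 u2 u3"
    and "span {t} = UNIV"
    and "e 1 = (u1, 0)" "e 2 = (u2, 0)" "e 3 = (u3, 0)" "e 4 = (0, t)"
    and "dual_basis e {1..4} \<epsilon>"
    and "lcs_structure (\<Omega>, \<theta>)"
  shows "\<exists>r>0. lcs_equivalent (\<Omega>, \<theta>)
    (\<lambda>x y. r * (wedge11 (\<epsilon> 1) (\<epsilon> 2) x y + wedge11 (\<epsilon> 3) (\<epsilon> 4) x y), \<epsilon> 4)"
proof -
  let ?K = "comb3 u1 u2 u3"
  have surjK: "surj ?K"
    using su2_standard_basis_bij_comb3[OF assms(1)] by (rule bij_is_surj)
  have coords: "\<exists>v s. X = (?K v, s)" for X :: "su2 \<times> real"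
    using surjD[OF surjK, of "fst X"] by (cases X) auto
  have t: "t \<noteq> 0"
  proof
    assume "t = 0"
    then have "(UNIV :: real set) = {0}" using assms(2) by simp
    then have "(1::real) \<in> {0}" by blast
    then show False by simp
  qed
  have lin\<epsilon>: "linear (\<epsilon> j)" if "j \<in> {1..4}" for j
    using assms(7) that by (simp add: dual_basis_def form1_def)
  have val\<epsilon>: "\<epsilon> j (e k) = (if j = k then 1 else 0)" if "j \<in> {1..4}" "k \<in> {1..4}" for j k
    using assms(7) that by (simp add: dual_basis_def)
  \<comment> \<open>The generator of the line is an arbitrary nonzero \<open>t\<close>, whence the
    coordinate s / t.\<close>
  have dec: "(?K v, s) = v $ 1 *\<^sub>R e 1 + v $ 2 *\<^sub>R e 2 + v $ 3 *\<^sub>R e 3 + (s / t) *\<^sub>R e 4" for v s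
    unfolding assms(3-6) using t by (simp add: comb3_def)
  have \<epsilon>: "\<epsilon> 1 (?K v, s) = v $ 1" "\<epsilon> 2 (?K v, s) = v $ 2" "\<epsilon> 3 (?K v, s) = v $ 3"
    "\<epsilon> 4 (?K v, s) = s / t" for v s
    unfolding dec by (simp_all add: linear_add[OF lin\<epsilon>] linear_scale[OF lin\<epsilon>] val\<epsilon>)
  obtain c \<alpha> x0 where c: "c \<noteq> 0" and \<alpha>: "linear \<alpha>" "\<alpha> x0 \<noteq> 0" and \<theta>: "\<And>x s. \<theta> (x, s) = c * s"
    and \<Omega>: "\<And>x s y s'. \<Omega> (x, s) (y, s') = - \<alpha> (lie x y) + c * (\<alpha> x * s' - \<alpha> y * s)"
    using lcs_structure_su2_real_primitive[OF assms(8)] by blast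
  obtain g r where g: "lie_automorphism g" and r: "r > 0"
    and \<alpha>g: "\<And>v. \<alpha> (g (?K v)) = r * v $ 3"
    using su2_automorphism_to_third_coordinate[OF assms(1) \<alpha>] by blast
  have lg: "linear g" and bg: "bij g" and hg: "g (lie x y) = lie (g x) (g y)" for x y
    using g by (auto simp: lie_automorphism_def)
  \<comment> \<open>The factor 1 / (c * t) is forced by pulling \<theta> back to
    \<open>\<epsilon> 4\<close>: c * (s / (c * t)) = s / t.\<close>
  define f where "f = map_prod g (\<lambda>s. s / (c * t))"
  have "bij (\<lambda>s. s / (c * t))"
    using c t by (intro bij_betwI[where g = "\<lambda>s. s * (c * t)"]) auto
  with bg have "bij f"
    unfolding f_def using bij_betw_map_prod[of g UNIV UNIV _ UNIV UNIV] by simp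
  moreover have "linear f"
    by (rule linearI)
      (auto simp: f_def linear_add[OF lg] linear_scale[OF lg] add_divide_distrib)
  moreover have "f (lie X Y) = lie (f X) (f Y)" for X Y
    by (simp add: f_def lie_prod_def lie_real_def hg)
  ultimately have f: "lie_automorphism f"
    by (simp add: lie_automorphism_def)
  have "\<theta> (f (?K v, s)) = \<epsilon> 4 (?K v, s)" for v s
    using c by (simp add: f_def \<theta> \<epsilon>)
  then have pull\<theta>: "\<theta> (f X) = \<epsilon> 4 X" for X
    using coords[of X] by auto
  have "\<Omega> (f (?K v, s)) (f (?K w, s'))
      = r * (wedge11 (\<epsilon> 1) (\<epsilon> 2) (?K v, s) (?K w, s') + wedge11 (\<epsilon> 3) (\<epsilon> 4) (?K v, s) (?K w, s'))"
    for v s w s'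
  proof -
    \<comment> \<open>The sign of the bracket cancels the one in d\<alpha>, so the third component
      of v \<times> w gives the term in \<open>\<epsilon> 1\<close> and \<open>\<epsilon> 2\<close>.
      In the mixed term c cancels, leaving the one in \<open>\<epsilon> 3\<close> and
      \<open>\<epsilon> 4\<close>.\<close>
    have "\<alpha> (lie (g (?K v)) (g (?K w))) = - (r * (v \<times> w) $ 3)"
      by (simp add: su2_standard_basis_lie_comb3[OF assms(1)] linear_neg[OF lg] linear_neg[OF \<alpha>(1)]
          \<alpha>g flip: hg)
    with c t show ?thesis
      unfolding wedge11_def \<epsilon>
      by (simp only: f_def map_prod_simp \<Omega> \<alpha>g cross_components) (simp add: field_simps)
  qed
  then have "\<Omega> (f X) (f Y) = r * (wedge11 (\<epsilon> 1) (\<epsilon> 2) X Y + wedge11 (\<epsilon> 3) (\<epsilon> 4) X Y)" for X Y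
    using coords[of X] coords[of Y] by auto
  with pull\<theta> have "pullback f (\<Omega>, \<theta>)
      = (\<lambda>x y. r * (wedge11 (\<epsilon> 1) (\<epsilon> 2) x y + wedge11 (\<epsilon> 3) (\<epsilon> 4) x y), \<epsilon> 4)"
    unfolding pullback_def by auto
  \<comment> \<open>Equivalence also asks that the normal form be an lcs structure; it is one, being
    a pullback of one.\<close>
  with lcs_structure_pullback[OF f assms(8)] f assms(8) r show ?thesis
    unfolding lcs_equivalent_def by (intro exI[of _ r]) auto
qed

end
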